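(* Let $\mathfrak{M}=(W,R,V)$ be an intuitionistic Kripke model. For every formula $\phi$ of the team language and every team $t\subseteq W$, $$\mathfrak{M},t\models\phi\iff\mathfrak{M}^\bullet,t\Vdash\phi^{\boldsymbol{\tau}} .$$
   Context: **Team language and semantics.** Fix a set $\mathsf{Prop}$ of propositional variables. Formulas of the team language are $\phi::=p\mid\bot\mid\phi\wedge\phi\mid\phi\vee\phi\mid\phi\veebar\phi\mid\phi\to\phi$; $\vee$ is the local and $\veebar$ the global disjunction. An intuitionistic Kripke model is $\mathfrak{M}=(W,R,V)$ with $W\neq\varnothing$, $R$ a partial order on $W$, and $V:\mathsf{Prop}\to\wp(W)$ persistent ($w\in V(p)$, $wRv$ imply $v\in V(p)$). A team is a set $t\subseteq W$. For teams, $tR^\circ s$ iff $\forall w\in t\,\exists v\in s\,(wRv)$ and $\forall v\in s\,\exists w\in t\,(wRv)$; $t\supseteq\circ R^\circ s$ iff there is $r\subseteq W$ with $t\supseteq r$ and $rR^\circ s$. Satisfaction: - $\mathfrak{M},t\models p$ iff $t\subseteq V(p)$; - $\mathfrak{M},t\models\bot$ iff $t=\varnothing$; - $\mathfrak{M},t\models\phi\wedge\psi$ iff $\mathfrak{M},t\models\phi$ and $\mathfrak{M},t\models\psi$; - $\mathfrak{M},t\models\phi\vee\psi$ iff there are $s,r\subseteq W$ with $t\subseteq s\cup r$, $\mathfrak{M},s\models\phi$ and $\mathfrak{M},r\models\psi$; - $\mathfrak{M},t\models\phi\veebar\psi$ iff $\mathfrak{M},t\models\phi$ or $\mathfrak{M},t\models\psi$;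 - $\mathfrak{M},t\models\phi\to\psi$ iff for all $s\subseteq W$ with $t\supseteq\circ R^\circ s$, $\mathfrak{M},s\models\phi$ implies $\mathfrak{M},s\models\psi$. **Full powerset model.** $\mathfrak{M}^\bullet=(\wp(W),\supseteq,R^\circ,\cup,\varnothing,V^\circ)$, where $R^\circ$ is the lifting above, $\cup$ is set-theoretic union, and $t\in V^\circ(p)$ iff $t\subseteq V(p)$. **Modal logic $\mathsf{IK}_\otimes$.** Formulas: $\phi::=p\mid\bot\mid\mathbf{0}\mid\phi\wedge\phi\mid\phi\vee\phi\mid\phi\otimes\phi\mid\phi\to\phi\mid\Box\phi$. In a structure $(X,\succcurlyeq,S,\Cup,0,U)$ (here $\mathfrak{M}^\bullet$, with $X=\wp(W)$, $\succcurlyeq$ being $\supseteq$, $S=R^\circ$, $\Cup=\cup$, $0=\varnothing$, $U=V^\circ$; $\preccurlyeq$ is the converse of $\succcurlyeq$), single-world satisfaction is: - $w\Vdash p$ iff $w\in U(p)$; $w\nVdash\bot$ always; $w\Vdash\mathbf{0}$ iff $w=0$; - $w\Vdash\phi\wedge\psi$ iff $w\Vdash\phi$ and $w\Vdash\psi$; $w\Vdash\phi\vee\psi$ iff $w\Vdash\phi$ or $w\Vdash\psi$; - $w\Vdash\phi\otimes\psi$ iff there are $u,v$ with $w\preccurlyeq u\Cup v$, $u\Vdash\phi$ and $v\Vdash\psi$; - $w\Vdash\phi\to\psi$ iff for all $v$ with $w\succcurlyeq v$, $v\Vdash\phi$ implies $v\Vdash\psi$; - $w\Vdash\Box\phi$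 iff for all $u,v$ with $w\succcurlyeq u$ and $uSv$, $v\Vdash\phi$. **Translation** from team formulas to $\mathsf{IK}_\otimes$-formulas: $p^{\boldsymbol{\tau}}=p$, $\bot^{\boldsymbol{\tau}}=\mathbf{0}$, $(\phi\vee\psi)^{\boldsymbol{\tau}}=\phi^{\boldsymbol{\tau}}\otimes\psi^{\boldsymbol{\tau}}$, $(\phi\veebar\psi)^{\boldsymbol{\tau}}=\phi^{\boldsymbol{\tau}}\vee\psi^{\boldsymbol{\tau}}$, $(\phi\wedge\psi)^{\boldsymbol{\tau}}=\phi^{\boldsymbol{\tau}}\wedge\psi^{\boldsymbol{\tau}}$, $(\phi\to\psi)^{\boldsymbol{\tau}}=\Box(\phi^{\boldsymbol{\tau}}\to\psi^{\boldsymbol{\tau}})$. *)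

theory Defs
  imports Main
begin

datatype 'p team_fm =
    TVar 'p
  | TBot
  | TAnd "'p team_fm" "'p team_fm"
  | TLor "'p team_fm" "'p team_fm"  \<comment> \<open>local disjunction \<open>\<or>\<close>\<close>
  | TGor "'p team_fm" "'p team_fm"  \<comment> \<open>global disjunction (barred \<open>\<or>\<close>)\<close>
  | TImp "'p team_fm" "'p team_fm"

record ('w, 'p) kripke =
  worlds :: "'w set"
  rel :: "('w \<times> 'w) set"
  val :: "'p \<Rightarrow> 'w set"

definition int_kripke_model :: "('w, 'p) kripke \<Rightarrow> bool" where
  "int_kripke_model M \<longleftrightarrow>
     worlds M \<noteq> {} \<and>
     partial_order_on (worlds M) (rel M) \<and>
     (\<forall>p. val M p \<subseteq> worlds M) \<and>
     (\<forall>p w v. w \<in> val M p \<and> (w, v) \<in> rel M \<longrightarrow> v \<in> val M p)"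

definition lift_rel :: "('w, 'p) kripke \<Rightarrow> ('w set \<times> 'w set) set" where
  "lift_rel M = {(t, s). t \<subseteq> worlds M \<and> s \<subseteq> worlds M \<and>
     (\<forall>w\<in>t. \<exists>v\<in>s. (w, v) \<in> rel M) \<and> (\<forall>v\<in>s. \<exists>w\<in>t. (w, v) \<in> rel M)}"

definition sup_lift_rel :: "('w, 'p) kripke \<Rightarrow> ('w set \<times> 'w set) set" where
  "sup_lift_rel M = {(t, s). \<exists>r. r \<subseteq> worlds M \<and> t \<supseteq> r \<and> (r, s) \<in> lift_rel M}"

primrec team_sat :: "('w, 'p) kripke \<Rightarrow> 'w set \<Rightarrow> 'p team_fm \<Rightarrow> bool" where
  "team_sat M t (TVar p) \<longleftrightarrow> t \<subseteq> val M p"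
| "team_sat M t TBot \<longleftrightarrow> t = {}"
| "team_sat M t (TAnd \<phi> \<psi>) \<longleftrightarrow> team_sat M t \<phi> \<and> team_sat M t \<psi>"
| "team_sat M t (TLor \<phi> \<psi>) \<longleftrightarrow>
     (\<exists>s r. s \<subseteq> worlds M \<and> r \<subseteq> worlds M \<and> t \<subseteq> s \<union> r \<and> team_sat M s \<phi> \<and> team_sat M r \<psi>)"
| "team_sat M t (TGor \<phi> \<psi>) \<longleftrightarrow> team_sat M t \<phi> \<or> team_sat M t \<psi>"
| "team_sat M t (TImp \<phi> \<psi>) \<longleftrightarrow>
     (\<forall>s. s \<subseteq> worlds M \<and> (t, s) \<in> sup_lift_rel M \<longrightarrow> team_sat M s \<phi> \<longrightarrow> team_sat M s \<psi>)"

datatype 'p modal_fm =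
    MVar 'p
  | MBot
  | MZero
  | MAnd "'p modal_fm" "'p modal_fm"
  | MOr "'p modal_fm" "'p modal_fm"
  | MTensor "'p modal_fm" "'p modal_fm"
  | MImp "'p modal_fm" "'p modal_fm"
  | MBox "'p modal_fm"

text \<open>
  In a structure, \<open>(x, y) \<in> geq A\<close> renders \<open>x \<succcurlyeq> y\<close>.
\<close>

record ('x, 'p) modal_struct =
  points :: "'x set"
  geq :: "('x \<times> 'x) set"
  acc :: "('x \<times> 'x) set"
  join :: "'x \<Rightarrow> 'x \<Rightarrow> 'x"
  zero :: "'x"
  mval :: "'p \<Rightarrow> 'x set"

primrec modal_sat :: "('x, 'p) modal_struct \<Rightarrow> 'x \<Rightarrow> 'p modal_fm \<Rightarrow> bool" where
  "modal_sat A w (MVar p) \<longleftrightarrow> w \<in> mval A p"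
| "modal_sat A w MBot \<longleftrightarrow> False"
| "modal_sat A w MZero \<longleftrightarrow> w = zero A"
| "modal_sat A w (MAnd \<phi> \<psi>) \<longleftrightarrow> modal_sat A w \<phi> \<and> modal_sat A w \<psi>"
| "modal_sat A w (MOr \<phi> \<psi>) \<longleftrightarrow> modal_sat A w \<phi> \<or> modal_sat A w \<psi>"
| "modal_sat A w (MTensor \<phi> \<psi>) \<longleftrightarrow>
     (\<exists>u\<in>points A. \<exists>v\<in>points A.
        (join A u v, w) \<in> geq A \<and> modal_sat A u \<phi> \<and> modal_sat A v \<psi>)"
| "modal_sat A w (MImp \<phi> \<psi>) \<longleftrightarrow>
     (\<forall>v\<in>points A. (w, v) \<in> geq A \<longrightarrow> modal_sat A v \<phi> \<longrightarrow> modal_sat A v \<psi>)"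
| "modal_sat A w (MBox \<phi>) \<longleftrightarrow>
     (\<forall>u\<in>points A. \<forall>v\<in>points A. (w, u) \<in> geq A \<and> (u, v) \<in> acc A \<longrightarrow> modal_sat A v \<phi>)"

definition full_powerset_model :: "('w, 'p) kripke \<Rightarrow> ('w set, 'p) modal_struct" where
  "full_powerset_model M =
     \<lparr> points = Pow (worlds M),
       geq = {(t, s). t \<subseteq> worlds M \<and> s \<subseteq> worlds M \<and> t \<supseteq> s},
       acc = lift_rel M,
       join = (\<union>),
       zero = {},
       mval = (\<lambda>p. {t. t \<subseteq> worlds M \<and> t \<subseteq> val M p}) \<rparr>"

primrec transl :: "'p team_fm \<Rightarrow> 'p modal_fm" where
  "transl (TVar p) = MVar p"
| "transl TBot = MZero"
| "transl (TAnd \<phi> \<psi>) = MAnd (transl \<phi>) (transl \<psi>)"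
| "transl (TLor \<phi> \<psi>) = MTensor (transl \<phi>) (transl \<psi>)"
| "transl (TGor \<phi> \<psi>) = MOr (transl \<phi>) (transl \<psi>)"
| "transl (TImp \<phi> \<psi>) = MBox (MImp (transl \<phi>) (transl \<psi>))"

end

theory Submission
  imports Defs
begin

text \<open>
  Induction on the formula; only implication is not immediate. There the modal clause quantifies over
  the teams related to \<open>t\<close> by \<open>\<supseteq> \<circ> R\<^sup>\<circ> \<circ> \<supseteq>\<close>, the team clause over those related
  by \<open>\<supseteq> \<circ> R\<^sup>\<circ>\<close>. The two relations coincide: if \<open>r R\<^sup>\<circ> v \<supseteq> s\<close>, the
  \<open>R\<close>-predecessors of \<open>s\<close> in \<open>r\<close> are lifted-related to \<open>s\<close>.
\<close>

lemma sup_lift_rel_supset: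
  assumes "(t, v) \<in> sup_lift_rel M" and "s \<subseteq> v"
  shows "(t, s) \<in> sup_lift_rel M"
proof -
  from assms(1) obtain r where r: "r \<subseteq> t" "(r, v) \<in> lift_rel M"
    by (auto simp: sup_lift_rel_def)
  \<comment> \<open>Cutting \<open>v\<close> down to \<open>s\<close> can leave points of
    \<open>r\<close> without a successor; discarding them restores the forth condition, and the back
    condition survives because every predecessor of a point of \<open>s\<close> is kept.\<close>
  define r' where "r' = {w \<in> r. \<exists>x\<in>s. (w, x) \<in> rel M}"
  have "(r', s) \<in> lift_rel M"
    using r(2) assms(2) unfolding lift_rel_def r'_def by blast
  moreover have "r' \<subseteq> worlds M" "r' \<subseteq> t"
    using r by (auto simp: lift_rel_def r'_def)
  ultimately show ?thesis
    by (auto simp: sup_lift_rel_def)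
qed

text \<open>The box contributes a shrinking followed by a lifted step, the inner implication one
  more shrinking, which \<open>sup_lift_rel_supset\<close> absorbs.\<close>

lemma modal_sat_box_imp_full_powerset_model:
  assumes "t \<subseteq> worlds M"
  shows "modal_sat (full_powerset_model M) t (MBox (MImp \<alpha> \<beta>)) \<longleftrightarrow>
    (\<forall>s. s \<subseteq> worlds M \<and> (t, s) \<in> sup_lift_rel M \<longrightarrow>
      modal_sat (full_powerset_model M) s \<alpha> \<longrightarrow> modal_sat (full_powerset_model M) s \<beta>)"
proof -
  let ?A = "full_powerset_model M"
  have points: "x \<in> points ?A \<longleftrightarrow> x \<subseteq> worlds M"
    and geq: "(x, y) \<in> geq ?A \<longleftrightarrow> x \<subseteq> worlds M \<and> y \<subseteq> worlds M \<and> y \<subseteq> x"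
    and acc: "acc ?A = lift_rel M" for x y
    by (simp_all add: full_powerset_model_def)
  have sup: "(t, v) \<in> sup_lift_rel M \<longleftrightarrow> (\<exists>u\<subseteq>t. (u, v) \<in> lift_rel M)" for v
    using assms by (auto simp: sup_lift_rel_def)
  have imp: "modal_sat ?A v (MImp \<alpha> \<beta>) \<longleftrightarrow>
      (\<forall>s\<subseteq>v. modal_sat ?A s \<alpha> \<longrightarrow> modal_sat ?A s \<beta>)" if "v \<subseteq> worlds M" for v
    using that by (auto simp: points geq)
  have "modal_sat ?A t (MBox (MImp \<alpha> \<beta>)) \<longleftrightarrow>
      (\<forall>v\<subseteq>worlds M. (t, v) \<in> sup_lift_rel M \<longrightarrow> modal_sat ?A v (MImp \<alpha> \<beta>))"
    unfolding modal_sat.simps(8) Ball_def points geq acc sup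
    using assms by (meson order_trans)
  also have "\<dots> \<longleftrightarrow> (\<forall>v\<subseteq>worlds M. (t, v) \<in> sup_lift_rel M \<longrightarrow>
      (\<forall>s\<subseteq>v. modal_sat ?A s \<alpha> \<longrightarrow> modal_sat ?A s \<beta>))"
    by (simp add: imp del: modal_sat.simps)
  also have "\<dots> \<longleftrightarrow> (\<forall>s. s \<subseteq> worlds M \<and> (t, s) \<in> sup_lift_rel M \<longrightarrow>
      modal_sat ?A s \<alpha> \<longrightarrow> modal_sat ?A s \<beta>)"
    (is "?L \<longleftrightarrow> ?R")
  proof
    assume L: ?L
    \<comment> \<open>The extra shrinking may be trivial: take \<open>v\<close> to be
      \<open>s\<close>.\<close>
    show ?R
      by (intro allI impI, elim conjE) (rule L[rule_format, OF _ _ subset_refl])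
  next
    assume R: ?R
    show ?L
    proof (intro allI impI)
      fix v s
      assume "v \<subseteq> worlds M" "(t, v) \<in> sup_lift_rel M" "s \<subseteq> v" "modal_sat ?A s \<alpha>"
      moreover from this have "s \<subseteq> worlds M" "(t, s) \<in> sup_lift_rel M"
        using sup_lift_rel_supset by (blast, metis)
      ultimately show "modal_sat ?A s \<beta>"
        using R by simp
    qed
  qed
  finally show ?thesis .
qed

theorem proposition4p12:
  fixes M :: "('w, 'p) kripke" and \<phi> :: "'p team_fm" and t :: "'w set"
  assumes "int_kripke_model M"
    and "t \<subseteq> worlds M"
  shows "team_sat M t \<phi> \<longleftrightarrow> modal_sat (full_powerset_model M) t (transl \<phi>)"
  using assms(2)
proof (induction \<phi> arbitrary: t)
  case (TLor \<phi> \<psi>)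
  \<comment> \<open>The bounds by \<open>worlds M\<close> stay explicit because the induction
    hypotheses cover only such teams.\<close>
  have "modal_sat (full_powerset_model M) t (transl (TLor \<phi> \<psi>)) \<longleftrightarrow>
    (\<exists>s r. s \<subseteq> worlds M \<and> r \<subseteq> worlds M \<and> t \<subseteq> s \<union> r \<and>
      modal_sat (full_powerset_model M) s (transl \<phi>) \<and>
      modal_sat (full_powerset_model M) r (transl \<psi>))"
    using TLor.prems by (simp add: full_powerset_model_def) blast
  then show ?case
    using TLor.IH by auto
next
  case (TImp \<phi> \<psi>)
  \<comment> \<open>Keeping \<open>modal_sat.simps\<close> out leaves the boxed implication intact
    for the lemma to rewrite as a whole.\<close>
  then show ?case
    by (simp add: modal_sat_box_imp_full_powerset_model del: modal_sat.simps)
qed (simp_all add: full_powerset_model_def)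

end
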